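(* Let $\langle X_*,f_*\rangle$ and $\langle X_*,g_*\rangle$ be sequences with the same sequence of objects in a locally complete MU-category $\mathcal{K}$. If $f_n\approx_{\varepsilon_n}g_n$ for every $n\in\omega$, where $\langle\varepsilon_n\rangle_{n\in\omega}$ is an epsilon sequence for both $f_*$ and $g_*$, then $f_*$ has a limit in $\mathcal{K}$ if and only if $g_*$ has a limit in $\mathcal{K}$, and any such limits are isomorphic.
   Context: An $\infty$-metric is a metric allowed to take the value $\infty$. An MU-category is a category $\mathcal{K}$ with an $\infty$-metric $d$ on every hom-set such that (1) $d(g\circ f,h\circ f)\le d(g,h)$ for all $\mathcal{K}$-maps $f$ and all compatible $g,h$, and (2) for every $\mathcal{K}$-map $f$ and $\varepsilon>0$ there is $\delta>0$ such that $f$ is $\langle\varepsilon,\delta\rangle$-continuous, i.e. for every $\mathcal{K}$-object $W$ and all $\mathcal{K}$-maps $g,h\colon W\to\mathrm{dom}(f)$, $d(g,h)<\delta$ implies $d(f\circ g,f\circ h)<\varepsilon$. It is locally complete if all the hom-spaces are complete. We write $f\approx_\varepsilon g$ for $d(f,g)<\varepsilon$. A sequence $\langle X_*,f_*\rangle$ in $\mathcal{K}$ consists of $\mathcal{K}$-objects $X_n$ and $\mathcal{K}$-maps $f_n\colon X_{n+1}\to X_n$, $n\in\omega$; for $n\le n'$ put $f_{n,n'}=f_n\circ\cdots\circ f_{n'-1}\colon X_{n'}\to X_n$ (so $f_{n,n}=\mathrm{id}$). A limit of the sequence is its category-theoretic (inverse) limit. An epsilon sequence for $f_*$ is a sequence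 $\langle\varepsilon_n\rangle_{n\in\omega}$ of strictly positive reals such that $f_{n,n'}$ is $\langle\varepsilon_n/2^{n'-n},\varepsilon_{n'}\rangle$-continuous for every $n\le n'\in\omega$. *)

theory Defs
  imports "HOL-Analysis.Analysis"
begin

record ('o, 'm) mu_data =
  Obj :: "'o set"
  Arr :: "'m set"
  Dom :: "'m \<Rightarrow> 'o"
  Cod :: "'m \<Rightarrow> 'o"
  Ident :: "'o \<Rightarrow> 'm"
  Comp :: "'m \<Rightarrow> 'm \<Rightarrow> 'm"  (infixl "\<cdot>\<index>" 70)
  Dist :: "'m \<Rightarrow> 'm \<Rightarrow> ennreal"

text \<open>
  \<open>g \<cdot> f\<close> is composition in the usual order (first \<open>f\<close>, then \<open>g\<close>); it is specified only when
  \<open>Dom g = Cod f\<close>. The distance is specified only for arrows in the same hom-set.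
\<close>

definition hom_set :: "('o, 'm) mu_data \<Rightarrow> 'o \<Rightarrow> 'o \<Rightarrow> 'm set" where
  "hom_set K A B = {f \<in> Arr K. Dom K f = A \<and> Cod K f = B}"

locale cat =
  fixes K :: "('o, 'm) mu_data" (structure)
  assumes Dom_Obj: "f \<in> Arr K \<Longrightarrow> Dom K f \<in> Obj K"
    and Cod_Obj: "f \<in> Arr K \<Longrightarrow> Cod K f \<in> Obj K"
    and Ident_hom: "A \<in> Obj K \<Longrightarrow> Ident K A \<in> hom_set K A A"
    and Comp_hom: "f \<in> hom_set K A B \<Longrightarrow> g \<in> hom_set K B C \<Longrightarrow> g \<cdot> f \<in> hom_set K A C"
    and Comp_Ident: "f \<in> hom_set K A B \<Longrightarrow> f \<cdot> Ident K A = f"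
    and Ident_Comp: "f \<in> hom_set K A B \<Longrightarrow> Ident K B \<cdot> f = f"
    and Comp_assoc: "f \<in> hom_set K A B \<Longrightarrow> g \<in> hom_set K B C \<Longrightarrow> h \<in> hom_set K C D \<Longrightarrow>
      (h \<cdot> g) \<cdot> f = h \<cdot> (g \<cdot> f)"

definition infty_metric_on :: "'a set \<Rightarrow> ('a \<Rightarrow> 'a \<Rightarrow> ennreal) \<Rightarrow> bool" where
  "infty_metric_on S d \<longleftrightarrow>
    (\<forall>x\<in>S. \<forall>y\<in>S. d x y = 0 \<longleftrightarrow> x = y) \<and>
    (\<forall>x\<in>S. \<forall>y\<in>S. d x y = d y x) \<and>
    (\<forall>x\<in>S. \<forall>y\<in>S. \<forall>z\<in>S. d x z \<le> d x y + d y z)"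

definition infty_complete_on :: "'a set \<Rightarrow> ('a \<Rightarrow> 'a \<Rightarrow> ennreal) \<Rightarrow> bool" where
  "infty_complete_on S d \<longleftrightarrow>
    (\<forall>s :: nat \<Rightarrow> 'a. (\<forall>n. s n \<in> S) \<longrightarrow>
      (\<forall>e::real. e > 0 \<longrightarrow> (\<exists>N. \<forall>m\<ge>N. \<forall>n\<ge>N. d (s m) (s n) < ennreal e)) \<longrightarrow>
      (\<exists>l\<in>S. (\<lambda>n. d (s n) l) \<longlonglongrightarrow> 0))"

definition eps_delta_continuous :: "('o, 'm) mu_data \<Rightarrow> real \<Rightarrow> real \<Rightarrow> 'm \<Rightarrow> bool" where
  "eps_delta_continuous K e \<delta> f \<longleftrightarrow>
    (\<forall>W\<in>Obj K. \<forall>g\<in>hom_set K W (Dom K f). \<forall>h\<in>hom_set K W (Dom K f).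
      Dist K g h < ennreal \<delta> \<longrightarrow> Dist K (f \<cdot>\<^bsub>K\<^esub> g) (f \<cdot>\<^bsub>K\<^esub> h) < ennreal e)"

locale MU_category = cat +
  assumes Dist_metric: "A \<in> Obj K \<Longrightarrow> B \<in> Obj K \<Longrightarrow> infty_metric_on (hom_set K A B) (Dist K)"
    and Dist_Comp_le: "f \<in> hom_set K A B \<Longrightarrow> g \<in> hom_set K B C \<Longrightarrow> h \<in> hom_set K B C \<Longrightarrow>
      Dist K (g \<cdot> f) (h \<cdot> f) \<le> Dist K g h"
    and Arr_continuous: "f \<in> Arr K \<Longrightarrow> (e::real) > 0 \<Longrightarrow> \<exists>\<delta>>0. eps_delta_continuous K e \<delta> f"

locale locally_complete_MU_category = MU_category +
  assumes hom_complete: "A \<in> Obj K \<Longrightarrow> B \<in> Obj K \<Longrightarrow> infty_complete_on (hom_set K A B) (Dist K)"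

definition approx_eq :: "('o, 'm) mu_data \<Rightarrow> real \<Rightarrow> 'm \<Rightarrow> 'm \<Rightarrow> bool" where
  "approx_eq K e f g \<longleftrightarrow> Dist K f g < ennreal e"

definition inv_sequence :: "('o, 'm) mu_data \<Rightarrow> (nat \<Rightarrow> 'o) \<Rightarrow> (nat \<Rightarrow> 'm) \<Rightarrow> bool" where
  "inv_sequence K X f \<longleftrightarrow> (\<forall>n. X n \<in> Obj K) \<and> (\<forall>n. f n \<in> hom_set K (X (Suc n)) (X n))"

text \<open>
  For \<open>n \<le> m\<close>, \<open>bonding K X f n m\<close> is the composite \<open>f n \<cdot> \<dots> \<cdot> f (m - 1) : X m \<rightarrow> X n\<close>,
  in particular the identity for \<open>m = n\<close>; its value for \<open>m < n\<close> is a dummy.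
\<close>

primrec bonding :: "('o, 'm) mu_data \<Rightarrow> (nat \<Rightarrow> 'o) \<Rightarrow> (nat \<Rightarrow> 'm) \<Rightarrow> nat \<Rightarrow> nat \<Rightarrow> 'm" where
  "bonding K X f n 0 = Ident K (X n)"
| "bonding K X f n (Suc m) =
    (if n \<le> m then bonding K X f n m \<cdot>\<^bsub>K\<^esub> f m else Ident K (X n))"

definition epsilon_sequence ::
  "('o, 'm) mu_data \<Rightarrow> (nat \<Rightarrow> 'o) \<Rightarrow> (nat \<Rightarrow> 'm) \<Rightarrow> (nat \<Rightarrow> real) \<Rightarrow> bool" where
  "epsilon_sequence K X f \<epsilon> \<longleftrightarrow>
    (\<forall>n. \<epsilon> n > 0) \<and>
    (\<forall>n m. n \<le> m \<longrightarrow> eps_delta_continuous K (\<epsilon> n / 2 ^ (m - n)) (\<epsilon> m) (bonding K X f n m))"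

definition is_cone ::
  "('o, 'm) mu_data \<Rightarrow> (nat \<Rightarrow> 'o) \<Rightarrow> (nat \<Rightarrow> 'm) \<Rightarrow> 'o \<Rightarrow> (nat \<Rightarrow> 'm) \<Rightarrow> bool" where
  "is_cone K X f L p \<longleftrightarrow>
    L \<in> Obj K \<and> (\<forall>n. p n \<in> hom_set K L (X n)) \<and> (\<forall>n. f n \<cdot>\<^bsub>K\<^esub> p (Suc n) = p n)"

definition is_limit ::
  "('o, 'm) mu_data \<Rightarrow> (nat \<Rightarrow> 'o) \<Rightarrow> (nat \<Rightarrow> 'm) \<Rightarrow> 'o \<Rightarrow> (nat \<Rightarrow> 'm) \<Rightarrow> bool" where
  "is_limit K X f L p \<longleftrightarrow>
    is_cone K X f L p \<and>
    (\<forall>W q. is_cone K X f W q \<longrightarrow> (\<exists>!u. u \<in> hom_set K W L \<and> (\<forall>n. p n \<cdot>\<^bsub>K\<^esub> u = q n)))"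

definition has_limit :: "('o, 'm) mu_data \<Rightarrow> (nat \<Rightarrow> 'o) \<Rightarrow> (nat \<Rightarrow> 'm) \<Rightarrow> bool" where
  "has_limit K X f \<longleftrightarrow> (\<exists>L p. is_limit K X f L p)"

definition isomorphic_objects :: "('o, 'm) mu_data \<Rightarrow> 'o \<Rightarrow> 'o \<Rightarrow> bool" where
  "isomorphic_objects K A B \<longleftrightarrow>
    (\<exists>u\<in>hom_set K A B. \<exists>v\<in>hom_set K B A. v \<cdot>\<^bsub>K\<^esub> u = Ident K A \<and> u \<cdot>\<^bsub>K\<^esub> v = Ident K B)"

end

theory Submission
  imports Defs
begin

text \<open>
  A cone \<open>p\<close> over \<open>f\<close> yields a cone \<open>q\<close> over \<open>g\<close> with the same apex by putting
  \<open>q n = lim (g n \<cdot> \<dots> \<cdot> g (m - 1) \<cdot> p m)\<close> as \<open>m \<rightarrow> \<infinity>\<close>: consecutive terms differ by less than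
  \<open>\<epsilon> n / 2 ^ (m - n)\<close>. This assignment commutes with precomposition, and the assignment with
  \<open>f\<close> and \<open>g\<close> exchanged is its inverse. Hence the cone functors of both sequences are naturally
  isomorphic, and so are the objects representing them.
\<close>

text \<open>A relation rather than a function, so that uniqueness, naturality and inversion can be
  shown before completeness supplies the limits. Writing the second index as \<open>n + k\<close>
  keeps \<open>bonding\<close> away from its dummy values and makes \<open>k\<close> the exponent in
  the error bounds.\<close>

definition cone_shift ::
  "('o, 'm) mu_data \<Rightarrow> (nat \<Rightarrow> 'o) \<Rightarrow> (nat \<Rightarrow> 'm) \<Rightarrow> (nat \<Rightarrow> 'm) \<Rightarrow> (nat \<Rightarrow> 'm) \<Rightarrow> bool" where
  "cone_shift K X g p q \<longleftrightarrow>
    (\<forall>n. (\<lambda>k. Dist K (bonding K X g n (n + k) \<cdot>\<^bsub>K\<^esub> p (n + k)) (q n)) \<longlonglongrightarrow> 0)"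

lemma hom_setD: "f \<in> hom_set K A B \<Longrightarrow> f \<in> Arr K \<and> Dom K f = A \<and> Cod K f = B"
  by (simp add: hom_set_def)

lemma tendsto_ennreal_div_pow2: "(\<lambda>k. ennreal (c / 2 ^ k)) \<longlonglongrightarrow> 0"
proof -
  have "(\<lambda>k. c * (1 / 2) ^ k) \<longlonglongrightarrow> c * 0"
    by (intro tendsto_mult tendsto_const LIMSEQ_power_zero) simp
  then have "(\<lambda>k. c / 2 ^ k) \<longlonglongrightarrow> 0"
    by (simp add: power_divide)
  then show ?thesis
    using tendsto_ennrealI by fastforce
qed

lemma eps_delta_continuousD:
  assumes "eps_delta_continuous K e \<delta> f" and "f \<in> hom_set K A B" and "W \<in> Obj K"
    and "g \<in> hom_set K W A" and "h \<in> hom_set K W A" and "Dist K g h < ennreal \<delta>"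
  shows "Dist K (f \<cdot>\<^bsub>K\<^esub> g) (f \<cdot>\<^bsub>K\<^esub> h) < ennreal e"
  using assms hom_setD[of f K A B] unfolding eps_delta_continuous_def by blast

section \<open>Bonding maps, cones and limits in a category\<close>

context cat
begin

lemma hom_Dom_Obj: "f \<in> hom_set K A B \<Longrightarrow> A \<in> Obj K"
  and hom_Cod_Obj: "f \<in> hom_set K A B \<Longrightarrow> B \<in> Obj K"
  using Dom_Obj Cod_Obj hom_setD by metis+

lemma bonding_hom:
  assumes "inv_sequence K X f" and "n \<le> m"
  shows "bonding K X f n m \<in> hom_set K (X m) (X n)"
  using assms(2)
proof (induction m)
  case 0
  then show ?case
    using assms(1) Ident_hom by (simp add: inv_sequence_def)
next
  case (Suc m)
  have "f m \<in> hom_set K (X (Suc m)) (X m)" "X n \<in> Obj K"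
    using assms(1) by (auto simp: inv_sequence_def)
  then show ?case
    using Suc by (auto simp: le_Suc_eq intro: Comp_hom Ident_hom)
qed

lemma bonding_self: "bonding K X f n n = Ident K (X n)"
  by (cases n) auto

text \<open>The recursion of \<open>bonding\<close> adds maps at the source end; the cone equation
  of a shifted cone composes at the target end and needs this form.\<close>

lemma bonding_Suc_left:
  assumes "inv_sequence K X f" and "Suc n \<le> m"
  shows "f n \<cdot> bonding K X f (Suc n) m = bonding K X f n m"
  using assms(2)
proof (induction m rule: dec_induct)
  case base
  have "f n \<in> hom_set K (X (Suc n)) (X n)"
    using assms(1) by (simp add: inv_sequence_def)
  then show ?case
    by (simp add: bonding_self Comp_Ident Ident_Comp)
next
  case (step m)
  have "f n \<in> hom_set K (X (Suc n)) (X n)" "f m \<in> hom_set K (X (Suc m)) (X m)"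
    using assms(1) by (auto simp: inv_sequence_def)
  then have "f n \<cdot> (bonding K X f (Suc n) m \<cdot> f m) = (f n \<cdot> bonding K X f (Suc n) m) \<cdot> f m"
    by (intro Comp_assoc[OF _ bonding_hom[OF assms(1) step(1)], symmetric])
  then show ?case
    using step by simp
qed

lemma bonding_cone:
  assumes "inv_sequence K X f" and "is_cone K X f W p" and "n \<le> m"
  shows "bonding K X f n m \<cdot> p m = p n"
  using assms(3)
proof (induction m rule: dec_induct)
  case base
  show ?case
    using assms(2) by (auto simp: bonding_self is_cone_def intro: Ident_Comp)
next
  case (step m)
  have "f m \<in> hom_set K (X (Suc m)) (X m)" "p (Suc m) \<in> hom_set K W (X (Suc m))"
    "f m \<cdot> p (Suc m) = p m"
    using assms(1,2) by (auto simp: inv_sequence_def is_cone_def)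
  then show ?case
    using step Comp_assoc[OF _ _ bonding_hom[OF assms(1) step(1)]] by simp
qed

lemma is_cone_comp:
  assumes "inv_sequence K X f" and "is_cone K X f L p" and "u \<in> hom_set K W L"
  shows "is_cone K X f W (\<lambda>n. p n \<cdot> u)"
  using assms hom_Dom_Obj[OF assms(3)] Comp_hom[OF assms(3)] Comp_assoc[OF assms(3)]
  unfolding is_cone_def inv_sequence_def by metis

text \<open>The mediating arrows between two limits compose to endomorphisms compatible with the
  projections, and the uniqueness of mediating arrows forces these to be identities.\<close>

lemma is_limit_isomorphic:
  assumes "inv_sequence K X f" and "is_limit K X f L p" and "is_limit K X f M q"
  shows "isomorphic_objects K L M"
proof -
  have endo: "w = Ident K A"
    if "is_limit K X f A r" "w \<in> hom_set K A A" "\<And>n. r n \<cdot> w = r n" for A r w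
  proof -
    have "is_cone K X f A r"
      using that(1) by (simp add: is_limit_def)
    moreover have "Ident K A \<in> hom_set K A A" "r n \<cdot> Ident K A = r n" for n
      using calculation by (auto simp: is_cone_def intro: Ident_hom Comp_Ident)
    ultimately show ?thesis
      using that unfolding is_limit_def by blast
  qed
  obtain u where u: "u \<in> hom_set K L M" "\<And>n. q n \<cdot> u = p n"
    using assms(2,3) unfolding is_limit_def by meson
  obtain v where v: "v \<in> hom_set K M L" "\<And>n. p n \<cdot> v = q n"
    using assms(2,3) unfolding is_limit_def by meson
  have pq: "p n \<in> hom_set K L (X n)" "q n \<in> hom_set K M (X n)" for n
    using assms(2,3) by (auto simp: is_limit_def is_cone_def)
  have "v \<cdot> u = Ident K L"
    using Comp_assoc[OF u(1) v(1) pq(1)] Comp_hom[OF u(1) v(1)] u v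
    by (intro endo[OF assms(2)]) auto
  moreover have "u \<cdot> v = Ident K M"
    using Comp_assoc[OF v(1) u(1) pq(2)] Comp_hom[OF v(1) u(1)] u v
    by (intro endo[OF assms(3)]) auto
  ultimately show ?thesis
    using u v unfolding isomorphic_objects_def by blast
qed

end

section \<open>Convergence in the hom-spaces\<close>

context MU_category
begin

lemma Dist_eq_0:
  "a \<in> hom_set K A B \<Longrightarrow> b \<in> hom_set K A B \<Longrightarrow> Dist K a b = 0 \<longleftrightarrow> a = b"
  using Dist_metric[of A B] hom_Dom_Obj[of a A B] hom_Cod_Obj[of a A B]
  unfolding infty_metric_on_def by blast

lemma Dist_commute:
  "a \<in> hom_set K A B \<Longrightarrow> b \<in> hom_set K A B \<Longrightarrow> Dist K a b = Dist K b a"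
  using Dist_metric[of A B] hom_Dom_Obj[of a A B] hom_Cod_Obj[of a A B]
  unfolding infty_metric_on_def by blast

lemma Dist_triangle:
  "a \<in> hom_set K A B \<Longrightarrow> b \<in> hom_set K A B \<Longrightarrow> c \<in> hom_set K A B \<Longrightarrow>
    Dist K a c \<le> Dist K a b + Dist K b c"
  using Dist_metric[of A B] hom_Dom_Obj[of a A B] hom_Cod_Obj[of a A B]
  unfolding infty_metric_on_def by blast

lemma Dist_limit_unique:
  assumes s: "\<And>n. s n \<in> hom_set K A B" and l: "l \<in> hom_set K A B" "l' \<in> hom_set K A B"
    and lim: "(\<lambda>n. Dist K (s n) l) \<longlonglongrightarrow> 0" "(\<lambda>n. Dist K (s n) l') \<longlonglongrightarrow> 0"
  shows "l = l'"
proof -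
  have "Dist K l l' \<le> Dist K (s n) l + Dist K (s n) l'" for n
    using Dist_triangle[OF l(1) s l(2)] Dist_commute[OF s l(1)] by metis
  moreover have "(\<lambda>n. Dist K (s n) l + Dist K (s n) l') \<longlonglongrightarrow> 0 + 0"
    using lim by (rule tendsto_add)
  ultimately have "Dist K l l' \<le> 0"
    by (intro tendsto_lowerbound[of "\<lambda>n. Dist K (s n) l + Dist K (s n) l'"]) auto
  then show ?thesis
    using Dist_eq_0[OF l] by simp
qed

text \<open>Postcomposition with \<open>f\<close> is uniformly continuous by
  \<open>Arr_continuous\<close>, hence preserves limits.\<close>

lemma tendsto_Comp_left:
  assumes s: "\<And>n. s n \<in> hom_set K A B" and l: "l \<in> hom_set K A B" and f: "f \<in> hom_set K B C"
    and lim: "(\<lambda>n. Dist K (s n) l) \<longlonglongrightarrow> 0"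
  shows "(\<lambda>n. Dist K (f \<cdot> s n) (f \<cdot> l)) \<longlonglongrightarrow> 0"
proof (rule order_tendstoI)
  fix e :: ennreal
  assume "0 < e"
  \<comment> \<open>\<open>e\<close> may be infinite, while \<open>Arr_continuous\<close> asks for a
    real tolerance.\<close>
  then obtain e' :: real where e': "0 < e'" "ennreal e' \<le> e"
    by (metis ennreal_cases ennreal_less_zero_iff order_refl top_greatest zero_less_one)
  obtain \<delta> where \<delta>: "\<delta> > 0" "eps_delta_continuous K e' \<delta> f"
    using Arr_continuous e'(1) f hom_setD by metis
  have "\<forall>\<^sub>F n in sequentially. Dist K (s n) l < ennreal \<delta>"
    using lim \<delta>(1) by (intro order_tendstoD) auto
  then show "\<forall>\<^sub>F n in sequentially. Dist K (f \<cdot> s n) (f \<cdot> l) < e"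
    by eventually_elim
      (use eps_delta_continuousD[OF \<delta>(2) f hom_Dom_Obj[OF l] s l] e'(2) in
        \<open>auto intro: less_le_trans\<close>)
qed simp

text \<open>Precomposition is nonexpansive, so the distances are squeezed between \<open>0\<close>
  and those from \<open>s n\<close> to \<open>l\<close>.\<close>

lemma tendsto_Comp_right:
  assumes s: "\<And>n. s n \<in> hom_set K A B" and l: "l \<in> hom_set K A B" and u: "u \<in> hom_set K W A"
    and lim: "(\<lambda>n. Dist K (s n) l) \<longlonglongrightarrow> 0"
  shows "(\<lambda>n. Dist K (s n \<cdot> u) (l \<cdot> u)) \<longlonglongrightarrow> 0"
  by (rule tendsto_sandwich[OF _ _ tendsto_const lim])
    (use Dist_Comp_le[OF u s l] in auto)

lemma Dist_geometric:
  assumes s: "\<And>n. s n \<in> hom_set K A B" and "c \<ge> 0"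
    and step: "\<And>k. Dist K (s k) (s (Suc k)) \<le> ennreal (c / 2 ^ k)"
  shows "Dist K (s k) (s (k + j)) \<le> ennreal (2 * c / 2 ^ k)"
proof -
  \<comment> \<open>The subtracted tail lets the induction close: the difference is exactly the sum
    of \<open>c / 2 ^ i\<close> over \<open>k \<le> i < k + j\<close>.\<close>
  have "Dist K (s k) (s (k + j)) \<le> ennreal (2 * c / 2 ^ k - 2 * c / 2 ^ (k + j))"
  proof (induction j)
    case 0
    then show ?case
      using Dist_eq_0[OF s s] by simp
  next
    case (Suc j)
    \<comment> \<open>Both summands must be nonnegative before \<open>ennreal\<close> can be pulled
      out of the sum.\<close>
    have "2 * c / 2 ^ (k + j) \<le> 2 * c / 2 ^ k"
      using \<open>c \<ge> 0\<close> by (intro divide_left_mono power_increasing) auto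
    then have "ennreal (2 * c / 2 ^ k - 2 * c / 2 ^ (k + j)) + ennreal (c / 2 ^ (k + j))
        = ennreal (2 * c / 2 ^ k - 2 * c / 2 ^ (k + Suc j))"
      using \<open>c \<ge> 0\<close> by (subst ennreal_plus[symmetric]) auto
    then show ?case
      using order_trans[OF Dist_triangle[OF s s s] add_mono[OF Suc step]] by simp
  qed
  also have "\<dots> \<le> ennreal (2 * c / 2 ^ k)"
    using \<open>c \<ge> 0\<close> by (intro ennreal_leI) auto
  finally show ?thesis .
qed

text \<open>The bound of \<open>Dist_geometric\<close> is uniform in \<open>j\<close>, so it
  survives the passage to the limit.\<close>

lemma Dist_geometric_limit:
  assumes s: "\<And>n. s n \<in> hom_set K A B" and "c \<ge> 0"
    and step: "\<And>k. Dist K (s k) (s (Suc k)) \<le> ennreal (c / 2 ^ k)"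
    and l: "l \<in> hom_set K A B" and lim: "(\<lambda>n. Dist K (s n) l) \<longlonglongrightarrow> 0"
  shows "Dist K (s k) l \<le> ennreal (2 * c / 2 ^ k)"
proof -
  have "Dist K (s k) l \<le> ennreal (2 * c / 2 ^ k) + Dist K (s (j + k)) l" for j
    using order_trans[OF Dist_triangle[OF s s l]
        add_right_mono[OF Dist_geometric[OF s \<open>c \<ge> 0\<close> step]]]
    by (metis add.commute)
  moreover have "(\<lambda>j. ennreal (2 * c / 2 ^ k) + Dist K (s (j + k)) l)
      \<longlonglongrightarrow> ennreal (2 * c / 2 ^ k) + 0"
    by (intro tendsto_add tendsto_const LIMSEQ_ignore_initial_segment[OF lim])
  ultimately show ?thesis
    by (intro tendsto_lowerbound[of
          "\<lambda>j. ennreal (2 * c / 2 ^ k) + Dist K (s (j + k)) l"]) auto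
qed

section \<open>Shifting a cone from one sequence to the other\<close>

lemma cone_shift_term_hom:
  assumes "inv_sequence K X g" and "is_cone K X f W p"
  shows "bonding K X g n (n + k) \<cdot> p (n + k) \<in> hom_set K W (X n)"
  using assms(2) by (intro Comp_hom[OF _ bonding_hom[OF assms(1)]]) (auto simp: is_cone_def)

text \<open>With \<open>m = n + k\<close>, both terms arise by applying
  \<open>bonding K X g n m\<close>: the first to \<open>p m = f m \<cdot> p (Suc m)\<close>, the
  second to \<open>g m \<cdot> p (Suc m)\<close>. These arguments differ by less than
  \<open>\<epsilon> m\<close>, which the epsilon sequence condition for \<open>g\<close> turns into
  \<open>\<epsilon> n / 2 ^ k\<close>.\<close>

lemma cone_shift_step:
  assumes "inv_sequence K X f" and g: "inv_sequence K X g" and "epsilon_sequence K X g \<epsilon>"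
    and "\<And>n. approx_eq K (\<epsilon> n) (f n) (g n)" and p: "is_cone K X f W p"
  shows "Dist K (bonding K X g n (n + k) \<cdot> p (n + k))
    (bonding K X g n (n + Suc k) \<cdot> p (n + Suc k)) < ennreal (\<epsilon> n / 2 ^ k)"
proof -
  let ?m = "n + k"
  have b: "bonding K X g n ?m \<in> hom_set K (X ?m) (X n)"
    using bonding_hom[OF g] by simp
  have c: "eps_delta_continuous K (\<epsilon> n / 2 ^ k) (\<epsilon> ?m) (bonding K X g n ?m)"
    using assms(3) unfolding epsilon_sequence_def by (metis add_diff_cancel_left' le_add1)
  have fm: "f ?m \<in> hom_set K (X (Suc ?m)) (X ?m)" and gm: "g ?m \<in> hom_set K (X (Suc ?m)) (X ?m)"
    using assms(1,2) by (auto simp: inv_sequence_def)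
  have pm: "p (Suc ?m) \<in> hom_set K W (X (Suc ?m))" and fp: "f ?m \<cdot> p (Suc ?m) = p ?m"
    and W: "W \<in> Obj K"
    using p by (auto simp: is_cone_def)
  have "Dist K (f ?m \<cdot> p (Suc ?m)) (g ?m \<cdot> p (Suc ?m)) < ennreal (\<epsilon> ?m)"
    using Dist_Comp_le[OF pm fm gm] assms(4)[of ?m] unfolding approx_eq_def
    by (rule le_less_trans)
  then have "Dist K (bonding K X g n ?m \<cdot> (f ?m \<cdot> p (Suc ?m)))
      (bonding K X g n ?m \<cdot> (g ?m \<cdot> p (Suc ?m))) < ennreal (\<epsilon> n / 2 ^ k)"
    by (intro eps_delta_continuousD[OF c b W] Comp_hom[OF pm] fm gm)
  then show ?thesis
    using Comp_assoc[OF pm gm b] fp by simp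
qed

lemma cone_shift_unique:
  assumes "inv_sequence K X g" and "is_cone K X f W p"
    and "is_cone K X h W q" and "is_cone K X h' W q'"
    and "cone_shift K X g p q" and "cone_shift K X g p q'"
  shows "q = q'"
proof
  fix n
  show "q n = q' n"
    using assms(3-) cone_shift_term_hom[OF assms(1,2)] unfolding cone_shift_def is_cone_def
    by (intro Dist_limit_unique[of "\<lambda>k. bonding K X g n (n + k) \<cdot> p (n + k)" W "X n"]) auto
qed

text \<open>Naturality of the shift in the apex: precomposition with \<open>u\<close> passes through
  the defining limits.\<close>

lemma cone_shift_comp:
  assumes g: "inv_sequence K X g" and p: "is_cone K X f L p" and q: "is_cone K X h L q"
    and "cone_shift K X g p q" and u: "u \<in> hom_set K W L"
  shows "cone_shift K X g (\<lambda>n. p n \<cdot> u) (\<lambda>n. q n \<cdot> u)"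
  unfolding cone_shift_def
proof
  fix n
  have "(\<lambda>k. Dist K ((bonding K X g n (n + k) \<cdot> p (n + k)) \<cdot> u) (q n \<cdot> u)) \<longlonglongrightarrow> 0"
    using assms cone_shift_term_hom[OF g p] unfolding cone_shift_def is_cone_def
    by (intro tendsto_Comp_right[of _ L "X n"]) auto
  moreover have "(bonding K X g n (n + k) \<cdot> p (n + k)) \<cdot> u
      = bonding K X g n (n + k) \<cdot> (p (n + k) \<cdot> u)" for k
    using p by (intro Comp_assoc[OF u _ bonding_hom[OF g]]) (auto simp: is_cone_def)
  ultimately show "(\<lambda>k. Dist K (bonding K X g n (n + k) \<cdot> (p (n + k) \<cdot> u)) (q n \<cdot> u)) \<longlonglongrightarrow> 0"
    by simp
qed

text \<open>
  The distance from \<open>p m\<close> to \<open>q m\<close> may exceed \<open>\<epsilon> m\<close>, so the continuity of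
  \<open>bonding K X f n m\<close> is applied along the chain \<open>p m\<close>, \<open>g m \<cdot> p (m + 1)\<close>,
  \<open>g m \<cdot> g (m + 1) \<cdot> p (m + 2)\<close>, \<open>q m\<close>, whose three steps are all smaller than \<open>\<epsilon> m\<close>.
\<close>

lemma cone_shift_inverse:
  assumes f: "inv_sequence K X f" and g: "inv_sequence K X g"
    and ef: "epsilon_sequence K X f \<epsilon>" and eg: "epsilon_sequence K X g \<epsilon>"
    and ap: "\<And>n. approx_eq K (\<epsilon> n) (f n) (g n)"
    and p: "is_cone K X f W p" and q: "is_cone K X g W q" and pq: "cone_shift K X g p q"
  shows "cone_shift K X f q p"
  unfolding cone_shift_def
proof
  fix n
  have pos: "\<epsilon> m > 0" for m
    using ef by (simp add: epsilon_sequence_def)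
  have W: "W \<in> Obj K" and ph: "\<And>m. p m \<in> hom_set K W (X m)" and qh: "\<And>m. q m \<in> hom_set K W (X m)"
    using p q by (auto simp: is_cone_def)
  \<comment> \<open>One term \<open>\<epsilon> n / 2 ^ k\<close> for each of the three steps of the
    chain; letting \<open>k\<close> grow gives the convergence.\<close>
  have "Dist K (bonding K X f n (n + k) \<cdot> q (n + k)) (p n) \<le> ennreal (3 * \<epsilon> n / 2 ^ k)" for k
  proof -
    let ?m = "n + k"
    let ?F = "bonding K X f n ?m"
    define b where "b j = bonding K X g ?m (?m + j) \<cdot> p (?m + j)" for j
    have bh: "b j \<in> hom_set K W (X ?m)" for j
      unfolding b_def by (rule cone_shift_term_hom[OF g p])
    have step: "Dist K (b j) (b (Suc j)) < ennreal (\<epsilon> ?m / 2 ^ j)" for j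
      unfolding b_def by (rule cone_shift_step[OF f g eg ap p])
    have b0: "b 0 = p ?m"
      using Ident_Comp[OF ph] by (simp add: b_def bonding_self)
    have d1: "Dist K (b 0) (b 1) < ennreal (\<epsilon> ?m)"
      using step[of 0] by simp
    have d2: "Dist K (b 1) (b 2) < ennreal (\<epsilon> ?m)"
      using pos[of ?m]
      by (intro less_le_trans[OF step[of 1, unfolded Suc_1]] ennreal_leI) simp
    \<comment> \<open>The limit estimate at index 2 is \<open>\<epsilon> ?m / 2\<close>; at index 1
      it would be \<open>\<epsilon> ?m\<close> itself, which is not the strict bound that continuity
      asks for.\<close>
    have "Dist K (b 2) (q ?m) \<le> ennreal (2 * \<epsilon> ?m / 2 ^ 2)"
      using pos[of ?m] pq unfolding cone_shift_def
      by (intro Dist_geometric_limit[OF bh _ less_imp_le[OF step] qh]) (auto simp: b_def)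
    also have "\<dots> < ennreal (\<epsilon> ?m)"
      using pos[of ?m] by (intro ennreal_lessI) auto
    finally have d3: "Dist K (b 2) (q ?m) < ennreal (\<epsilon> ?m)" .
    have F: "?F \<in> hom_set K (X ?m) (X n)"
      using bonding_hom[OF f] by simp
    have c: "eps_delta_continuous K (\<epsilon> n / 2 ^ k) (\<epsilon> ?m) ?F"
      using ef unfolding epsilon_sequence_def by (metis add_diff_cancel_left' le_add1)
    note FD = eps_delta_continuousD[OF c F W, THEN less_imp_le]
    have Fb: "?F \<cdot> b j \<in> hom_set K W (X n)" and Fq: "?F \<cdot> q ?m \<in> hom_set K W (X n)" for j
      using F bh qh by (auto intro: Comp_hom)
    \<comment> \<open>Since \<open>b 0\<close> is \<open>p ?m\<close>, the cone equation of
      \<open>p\<close> over \<open>f\<close> identifies \<open>?F \<cdot> b 0\<close> with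
      \<open>p n\<close>.\<close>
    have "Dist K (?F \<cdot> q ?m) (p n) = Dist K (?F \<cdot> b 0) (?F \<cdot> q ?m)"
      using bonding_cone[OF f p, of n ?m] Dist_commute[OF Fq Fb[of 0]] b0 by simp
    also have "\<dots> \<le> Dist K (?F \<cdot> b 0) (?F \<cdot> b 1)
        + (Dist K (?F \<cdot> b 1) (?F \<cdot> b 2) + Dist K (?F \<cdot> b 2) (?F \<cdot> q ?m))"
      by (rule order_trans[OF Dist_triangle[OF Fb Fb Fq] add_left_mono[OF Dist_triangle[OF Fb Fb Fq]]])
    also have "\<dots> \<le> ennreal (\<epsilon> n / 2 ^ k) + (ennreal (\<epsilon> n / 2 ^ k) + ennreal (\<epsilon> n / 2 ^ k))"
      by (intro add_mono FD bh qh d1 d2 d3)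
    also have "\<dots> = ennreal (3 * \<epsilon> n / 2 ^ k)"
      using pos[of n] by (simp add: ennreal_plus[symmetric] del: ennreal_plus)
    finally show ?thesis .
  qed
  then show "(\<lambda>k. Dist K (bonding K X f n (n + k) \<cdot> q (n + k)) (p n)) \<longlonglongrightarrow> 0"
    by (intro tendsto_sandwich[OF _ _ tendsto_const tendsto_ennreal_div_pow2[of "3 * \<epsilon> n"]]) auto
qed

end

section \<open>Existence of shifted cones by completeness, and transfer of limits\<close>

context locally_complete_MU_category
begin

lemma geometric_convergent:
  assumes s: "\<And>n. s n \<in> hom_set K A B" and "c \<ge> 0"
    and step: "\<And>k. Dist K (s k) (s (Suc k)) \<le> ennreal (c / 2 ^ k)"
  shows "\<exists>l\<in>hom_set K A B. (\<lambda>n. Dist K (s n) l) \<longlonglongrightarrow> 0"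
proof -
  have "\<exists>N. \<forall>m\<ge>N. \<forall>n\<ge>N. Dist K (s m) (s n) < ennreal e" if "e > 0" for e :: real
  proof -
    \<comment> \<open>Two terms of the sequence are each compared with \<open>s N\<close> at cost
      \<open>2 * c / 2 ^ N\<close>, hence the factor 4.\<close>
    have "\<forall>\<^sub>F k in sequentially. ennreal (4 * c / 2 ^ k) < ennreal e"
      using tendsto_ennreal_div_pow2 that by (intro order_tendstoD) auto
    then obtain N where N: "ennreal (4 * c / 2 ^ N) < ennreal e"
      by (auto simp: eventually_sequentially)
    have near: "Dist K (s N) (s m) \<le> ennreal (2 * c / 2 ^ N)" if "m \<ge> N" for m
      using Dist_geometric[OF s \<open>c \<ge> 0\<close> step, of N "m - N"] that by simp
    have "Dist K (s m) (s n) < ennreal e" if "m \<ge> N" "n \<ge> N" for m n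
    proof -
      have "Dist K (s m) (s n) \<le> Dist K (s N) (s m) + Dist K (s N) (s n)"
        using Dist_triangle[OF s[of m] s[of N] s[of n]] Dist_commute[OF s s] by metis
      also have "\<dots> \<le> ennreal (2 * c / 2 ^ N) + ennreal (2 * c / 2 ^ N)"
        by (intro add_mono near that)
      also have "\<dots> = ennreal (4 * c / 2 ^ N)"
        using \<open>c \<ge> 0\<close> by (simp add: ennreal_plus[symmetric] del: ennreal_plus)
      finally show ?thesis
        using N by (rule le_less_trans)
    qed
    then show ?thesis
      by blast
  qed
  then show ?thesis
    using hom_complete[OF hom_Dom_Obj[OF s] hom_Cod_Obj[OF s]] s
    unfolding infty_complete_on_def by blast
qed

text \<open>Completeness provides each \<open>q n\<close>. The cone equation holds because
  \<open>q n\<close> and \<open>g n \<cdot> q (Suc n)\<close> are limits of the same sequence, the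
  second by continuity of postcomposition with \<open>g n\<close>.\<close>

lemma cone_shift_exists:
  assumes f: "inv_sequence K X f" and g: "inv_sequence K X g" and eg: "epsilon_sequence K X g \<epsilon>"
    and ap: "\<And>n. approx_eq K (\<epsilon> n) (f n) (g n)" and p: "is_cone K X f W p"
  shows "\<exists>q. is_cone K X g W q \<and> cone_shift K X g p q"
proof -
  define b where "b n k = bonding K X g n (n + k) \<cdot> p (n + k)" for n k
  have bh: "b n k \<in> hom_set K W (X n)" for n k
    unfolding b_def by (rule cone_shift_term_hom[OF g p])
  have "\<exists>l\<in>hom_set K W (X n). (\<lambda>k. Dist K (b n k) l) \<longlonglongrightarrow> 0" for n
  proof (rule geometric_convergent[OF bh])
    show "0 \<le> \<epsilon> n"
      using eg by (simp add: epsilon_sequence_def less_imp_le)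
    show "Dist K (b n k) (b n (Suc k)) \<le> ennreal (\<epsilon> n / 2 ^ k)" for k
      unfolding b_def by (rule less_imp_le[OF cone_shift_step[OF f g eg ap p]])
  qed
  then obtain q where qh: "\<And>n. q n \<in> hom_set K W (X n)"
    and lim: "\<And>n. (\<lambda>k. Dist K (b n k) (q n)) \<longlonglongrightarrow> 0"
    by metis
  have "g n \<cdot> q (Suc n) = q n" for n
  proof (rule Dist_limit_unique[of "\<lambda>k. b n (Suc k)"])
    have gn: "g n \<in> hom_set K (X (Suc n)) (X n)"
      using g by (simp add: inv_sequence_def)
    show "g n \<cdot> q (Suc n) \<in> hom_set K W (X n)"
      using qh gn by (rule Comp_hom)
    \<comment> \<open>Both sides start from \<open>p (n + k + 1)\<close>, which is why the tail of
      \<open>b n\<close> from index 1 on is compared.\<close>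
    have "g n \<cdot> b (Suc n) k = b n (Suc k)" for k
    proof -
      have "p (Suc n + k) \<in> hom_set K W (X (Suc n + k))"
        using p unfolding is_cone_def by blast
      then have "g n \<cdot> b (Suc n) k = (g n \<cdot> bonding K X g (Suc n) (Suc n + k)) \<cdot> p (Suc n + k)"
        unfolding b_def by (intro Comp_assoc[OF _ bonding_hom[OF g] gn, symmetric]) auto
      then show ?thesis
        using bonding_Suc_left[OF g, of n "Suc n + k"] by (simp add: b_def)
    qed
    then show "(\<lambda>k. Dist K (b n (Suc k)) (g n \<cdot> q (Suc n))) \<longlonglongrightarrow> 0"
      using tendsto_Comp_left[OF bh qh gn lim] by simp
    show "(\<lambda>k. Dist K (b n (Suc k)) (q n)) \<longlonglongrightarrow> 0"
      by (rule LIMSEQ_Suc[OF lim])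
  qed (rule bh qh)+
  then have "is_cone K X g W q"
    using p qh by (simp add: is_cone_def)
  then show ?thesis
    using lim by (auto simp: cone_shift_def b_def)
qed

text \<open>The apex is kept: the shift \<open>q\<close> of the universal cone \<open>p\<close> is
  again universal, since factorizations through \<open>q\<close> correspond to factorizations
  through \<open>p\<close>.\<close>

lemma is_limit_transfer:
  assumes f: "inv_sequence K X f" and g: "inv_sequence K X g"
    and ef: "epsilon_sequence K X f \<epsilon>" and eg: "epsilon_sequence K X g \<epsilon>"
    and fg: "\<And>n. approx_eq K (\<epsilon> n) (f n) (g n)" and gf: "\<And>n. approx_eq K (\<epsilon> n) (g n) (f n)"
    and lim: "is_limit K X f L p"
  shows "\<exists>q. is_limit K X g L q"
proof -
  have p: "is_cone K X f L p"
    using lim by (simp add: is_limit_def)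
  obtain q where q: "is_cone K X g L q" and pq: "cone_shift K X g p q"
    using cone_shift_exists[OF f g eg fg p] by blast
  have qp: "cone_shift K X f q p"
    by (rule cone_shift_inverse[OF f g ef eg fg p q pq])
  have "\<exists>!u. u \<in> hom_set K W L \<and> (\<forall>n. q n \<cdot> u = r n)" if r: "is_cone K X g W r" for W r
  proof -
    obtain s where s: "is_cone K X f W s" and rs: "cone_shift K X f r s"
      using cone_shift_exists[OF g f ef gf r] by blast
    have sr: "cone_shift K X g s r"
      by (rule cone_shift_inverse[OF g f eg ef gf r s rs])
    \<comment> \<open>Each direction compares two shifts of one cone, one of them obtained by
      composing with \<open>u\<close>: \<open>qp\<close> and \<open>rs\<close> serve the first
      direction, \<open>pq\<close> and \<open>sr\<close> the second.\<close>
    have iff: "(\<forall>n. q n \<cdot> u = r n) \<longleftrightarrow> (\<forall>n. p n \<cdot> u = s n)" if u: "u \<in> hom_set K W L" for u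
    proof
      assume "\<forall>n. q n \<cdot> u = r n"
      then have "cone_shift K X f r (\<lambda>n. p n \<cdot> u)"
        using cone_shift_comp[OF f q p qp u] by simp
      then show "\<forall>n. p n \<cdot> u = s n"
        using cone_shift_unique[OF f r is_cone_comp[OF f p u] s _ rs] by metis
    next
      assume "\<forall>n. p n \<cdot> u = s n"
      then have "cone_shift K X g s (\<lambda>n. q n \<cdot> u)"
        using cone_shift_comp[OF g p q pq u] by simp
      then show "\<forall>n. q n \<cdot> u = r n"
        using cone_shift_unique[OF g s is_cone_comp[OF g q u] r _ sr] by metis
    qed
    have "\<exists>!u. u \<in> hom_set K W L \<and> (\<forall>n. p n \<cdot> u = s n)"
      using lim s by (simp add: is_limit_def)
    then show ?thesis
      using iff by metis
  qed
  then show ?thesis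
    using q unfolding is_limit_def by blast
qed

end

theorem corollary3p20:
  fixes K :: "('o, 'm) mu_data"
    and X :: "nat \<Rightarrow> 'o"
    and f g :: "nat \<Rightarrow> 'm"
    and \<epsilon> :: "nat \<Rightarrow> real"
  assumes "locally_complete_MU_category K"
    and "inv_sequence K X f" and "inv_sequence K X g"
    and "epsilon_sequence K X f \<epsilon>" and "epsilon_sequence K X g \<epsilon>"
    and "\<And>n. approx_eq K (\<epsilon> n) (f n) (g n)"
  shows "(has_limit K X f \<longleftrightarrow> has_limit K X g) \<and>
    (\<forall>L p M q. is_limit K X f L p \<longrightarrow> is_limit K X g M q \<longrightarrow> isomorphic_objects K L M)"
proof -
  interpret locally_complete_MU_category K
    by (rule assms(1))
  \<comment> \<open>Closeness is needed in both orders, as cones are shifted back and forth.\<close>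
  have "Dist K (f n) (g n) = Dist K (g n) (f n)" for n
    using assms(2,3) Dist_commute[of "f n" "X (Suc n)" "X n" "g n"] by (simp add: inv_sequence_def)
  then have gf: "approx_eq K (\<epsilon> n) (g n) (f n)" for n
    using assms(6)[of n] by (simp add: approx_eq_def)
  note fg_limit = is_limit_transfer[OF assms(2-6) gf]
    and gf_limit = is_limit_transfer[OF assms(3,2,5,4) gf assms(6)]
  \<comment> \<open>Transfer keeps the apex, so \<open>L\<close> is itself a limit object of
    \<open>g\<close> and can be compared with \<open>M\<close> over the same sequence.\<close>
  have "isomorphic_objects K L M" if "is_limit K X f L p" "is_limit K X g M q" for L p M q
    using fg_limit[OF that(1)] is_limit_isomorphic[OF assms(3) _ that(2)] by blast
  moreover have "has_limit K X f \<longleftrightarrow> has_limit K X g"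
    unfolding has_limit_def using fg_limit gf_limit by blast
  ultimately show ?thesis
    by blast
qed

end
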